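(* For all reals $\lambda>0$ and all integers $d\ge1$, $k\ge1$, \[ \inf_{t > 3} \frac{\sigma^2(t)}{t^d} > 0 . \]
   Context: For $V \subseteq \mathbb{R}^d$ and $r>0$, $G_r(V)$ is the graph with vertex set $V$ in which two distinct points $u,v\in V$ are adjacent if and only if $\|u-v\|\le r$ (Euclidean norm). For $k \in \mathbb{N}=\{1,2,\dots\}$ and finite $V$, $N_{k,r}(V)$ is the maximum number of vertices of $G_r(V)$ that can be properly colored with $k$ colors, i.e., the largest cardinality of a subset $U\subseteq V$ such that the induced subgraph $G_r(U)$ is $k$-colorable. $\mathcal{X}_\lambda$ is a Poisson point process of (constant) intensity $\lambda$ in $\mathbb{R}^d$, $F_{k,\lambda}(t) = N_{k,1}([0,t]^d \cap \mathcal{X}_\lambda)$, and $\sigma^2(t)=\mathrm{Var}\{F_{k,\lambda}(t)\}$. *)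

theory Defs
  imports "HOL-Probability.Probability"
begin

section \<open>Geometric graphs and partial colorings\<close>

text \<open>A simple graph is a pair of a vertex set and a set of two-element edges.\<close>

definition geometric_graph :: "real \<Rightarrow> 'a::real_normed_vector set \<Rightarrow> 'a set \<times> 'a set set" where
  "geometric_graph r V = (V, {{u, v} | u v. u \<in> V \<and> v \<in> V \<and> u \<noteq> v \<and> norm (u - v) \<le> r})"

definition colorable :: "nat \<Rightarrow> 'a set \<times> 'a set set \<Rightarrow> bool" where
  "colorable k G \<longleftrightarrow>
     (\<exists>c :: 'a \<Rightarrow> nat. (\<forall>v \<in> fst G. c v < k) \<and> (\<forall>u v. {u, v} \<in> snd G \<longrightarrow> c u \<noteq> c v))"

text \<open>The induced subgraph of \<open>geometric_graph r V\<close> on \<open>U \<subseteq> V\<close> is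
  \<open>geometric_graph r U\<close>. The maximum is meaningful for finite \<open>V\<close> only.\<close>

definition max_colorable :: "nat \<Rightarrow> real \<Rightarrow> 'a::real_normed_vector set \<Rightarrow> nat" where
  "max_colorable k r V = Max {card U | U. U \<subseteq> V \<and> colorable k (geometric_graph r U)}"


section \<open>Homogeneous Poisson point processes\<close>

text \<open>The constant \<open>poisson_pmf\<close> is only specified for positive rates; rate \<open>0\<close> gives the
  point mass at \<open>0\<close>.\<close>

definition poisson_law :: "real \<Rightarrow> nat pmf" where
  "poisson_law m = (if m > 0 then poisson_pmf m else return_pmf 0)"

text \<open>A homogeneous Poisson process is almost surely simple, so it is modelled as a random locally
  finite set of points \<open>X \<omega>\<close>; being a random set means that the counts on bounded Borel sets are
  random variables.\<close>

locale poisson_process = prob_space M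
  for M :: "'w measure" and intensity :: real and X :: "'w \<Rightarrow> 'a::euclidean_space set" +
  assumes intensity_pos: "0 < intensity"
    and locally_finite: "\<And>\<omega> A. \<omega> \<in> space M \<Longrightarrow> bounded A \<Longrightarrow> finite (X \<omega> \<inter> A)"
    and count_measurable: "\<And>A. A \<in> sets borel \<Longrightarrow> bounded A \<Longrightarrow>
      random_variable (count_space UNIV) (\<lambda>\<omega>. card (X \<omega> \<inter> A))"
    and count_law: "\<And>A. A \<in> sets borel \<Longrightarrow> bounded A \<Longrightarrow>
      distr M (count_space UNIV) (\<lambda>\<omega>. card (X \<omega> \<inter> A)) =
        measure_pmf (poisson_law (intensity * measure lborel A))"
    and count_indep: "\<And>(n :: nat) A. (\<And>i. i < n \<Longrightarrow> A i \<in> sets borel \<and> bounded (A i)) \<Longrightarrow>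
      disjoint_family_on A {..<n} \<Longrightarrow>
      indep_vars (\<lambda>_. count_space UNIV) (\<lambda>i \<omega>. card (X \<omega> \<inter> A i)) {..<n}"


section \<open>The functional and its variance\<close>

definition cube :: "real \<Rightarrow> (real ^ 'd) set" where
  "cube t = {x. \<forall>i. 0 \<le> x $ i \<and> x $ i \<le> t}"

definition colorable_count :: "nat \<Rightarrow> ('w \<Rightarrow> (real ^ 'd) set) \<Rightarrow> real \<Rightarrow> 'w \<Rightarrow> real" where
  "colorable_count k X t \<omega> = real (max_colorable k 1 (cube t \<inter> X \<omega>))"

definition colorable_variance ::
    "'w measure \<Rightarrow> nat \<Rightarrow> ('w \<Rightarrow> (real ^ 'd) set) \<Rightarrow> real \<Rightarrow> real" where
  "colorable_variance M k X t = prob_space.variance M (colorable_count k X t)"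

end

theory Submission
  imports Defs
begin

text \<open>Place \<open>n ^ d\<close> disjoint balls of radius \<open>3/2\<close>, with \<open>n = \<lfloor>t / 3\<rfloor>\<close>, in the cube. The points in the
  core (radius \<open>1/4\<close>) of a ball form a clique, and if the rest of the ball is empty then they are
  isolated from all other points, so that \<open>F = G + min k N\<close>, where \<open>G\<close> only depends on the points
  outside the ball and \<open>N\<close> is the number of points in the core. Let \<open>Z\<close> be \<open>min k N - E (min k N)\<close>
  times the indicator that the rest of the ball is empty. Then \<open>E Z = 0\<close> and, by independence,
  \<open>E (F Z) = E Z\<^sup>2 = s > 0\<close>, with \<open>s\<close> the same for all balls, and the \<open>Z\<close> of different balls are
  orthogonal. Expanding \<open>0 \<le> E (F - E F - \<Sum>Z)\<^sup>2\<close> gives \<open>Var F \<ge> n ^ d * s\<close>.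

  Measurability of \<open>G\<close> and its independence from the counts inside the ball are obtained by rounding
  the points to finer and finer grids.\<close>

subsection \<open>Partial colorings of geometric graphs\<close>

text \<open>An edge \<open>{u, v}\<close> does not remember the order of its endpoints, and the
  symmetry of the norm makes this harmless. All later colorings are built and used in this pointwise
  form.\<close>

lemma colorable_geometric_graph:
  "colorable k (geometric_graph r U) \<longleftrightarrow>
    (\<exists>c :: _ \<Rightarrow> nat. (\<forall>v\<in>U. c v < k) \<and>
      (\<forall>u\<in>U. \<forall>v\<in>U. u \<noteq> v \<longrightarrow> norm (u - v) \<le> r \<longrightarrow> c u \<noteq> c v))"
proof -
  have "(\<forall>u v. {u, v} \<in> snd (geometric_graph r U) \<longrightarrow> c u \<noteq> c v) \<longleftrightarrow>
      (\<forall>u\<in>U. \<forall>v\<in>U. u \<noteq> v \<longrightarrow> norm (u - v) \<le> r \<longrightarrow> c u \<noteq> c v)" for c :: "_ \<Rightarrow> nat"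
  proof -
    have "{u, v} \<in> snd (geometric_graph r U) \<longleftrightarrow>
        u \<in> U \<and> v \<in> U \<and> u \<noteq> v \<and> norm (u - v) \<le> r" for u v
      unfolding geometric_graph_def by (auto simp: doubleton_eq_iff norm_minus_commute)
    then show ?thesis by blast
  qed
  then show ?thesis by (simp add: colorable_def geometric_graph_def)
qed

lemma colorable_geometric_graphE:
  assumes "colorable k (geometric_graph r U)"
  obtains c :: "_ \<Rightarrow> nat" where "\<forall>v\<in>U. c v < k"
    "\<forall>u\<in>U. \<forall>v\<in>U. u \<noteq> v \<longrightarrow> norm (u - v) \<le> r \<longrightarrow> c u \<noteq> c v"
  using assms that unfolding colorable_geometric_graph by (elim exE conjE)

lemma colorable_geometric_graph_mono:
  "colorable k (geometric_graph r U) \<Longrightarrow> W \<subseteq> U \<Longrightarrow> colorable k (geometric_graph r W)"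
  unfolding colorable_geometric_graph by (elim ex_forward) auto

lemma max_colorable_eq_Max_image:
  "max_colorable k r V = Max (card ` {U. U \<subseteq> V \<and> colorable k (geometric_graph r U)})"
  unfolding max_colorable_def by (rule arg_cong[of _ _ Max]) (simp add: setcompr_eq_image)

lemma max_colorable_ge:
  assumes "finite V" "U \<subseteq> V" "colorable k (geometric_graph r U)"
  shows "card U \<le> max_colorable k r V"
  unfolding max_colorable_eq_Max_image using assms by (intro Max_ge) auto

lemma max_colorable_witness:
  assumes "finite V"
  obtains U where "U \<subseteq> V" "colorable k (geometric_graph r U)" "card U = max_colorable k r V"
proof -
  let ?\<U> = "{U. U \<subseteq> V \<and> colorable k (geometric_graph r U)}"
  have "colorable k (geometric_graph r {})" by (simp add: colorable_geometric_graph)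
  then have "{} \<in> ?\<U>" by simp
  then have "Max (card ` ?\<U>) \<in> card ` ?\<U>" using assms by (intro Max_in) auto
  then show ?thesis using that unfolding max_colorable_eq_Max_image by auto
qed

lemma max_colorable_le_card:
  assumes "finite V"
  shows "max_colorable k r V \<le> card V"
proof -
  obtain U where "U \<subseteq> V" "colorable k (geometric_graph r U)" "card U = max_colorable k r V"
    using max_colorable_witness[OF assms] .
  then show ?thesis using card_mono[OF assms, of U] by simp
qed

text \<open>No edge joins \<open>V\<close> and \<open>W\<close>. So a colorable set splits into its
  traces on the two sides, and conversely colorings of the two sides glue to a proper coloring of
  the union.\<close>

lemma max_colorable_Un:
  assumes fin: "finite V" "finite W" and r: "0 \<le> r"
    and far: "\<And>u v. u \<in> V \<Longrightarrow> v \<in> W \<Longrightarrow> r < norm (u - v)"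
  shows "max_colorable k r (V \<union> W) = max_colorable k r V + max_colorable k r W"
proof (rule antisym)
  \<comment> \<open>A common point would have distance 0 from itself, which cannot exceed
    \<open>r\<close>.\<close>
  have disj: "V \<inter> W = {}" using far r by fastforce
  have finU: "finite (V \<union> W)" using fin by simp
  obtain U where U: "U \<subseteq> V \<union> W" "colorable k (geometric_graph r U)" 
    "card U = max_colorable k r (V \<union> W)"
    using max_colorable_witness[OF finU] .
  have "U = (U \<inter> V) \<union> (U \<inter> W)" using U(1) by blast
  then have "card U = card (U \<inter> V) + card (U \<inter> W)"
    using card_Un_disjoint[of "U \<inter> V" "U \<inter> W"] disj fin by auto
  also have "\<dots> \<le> max_colorable k r V + max_colorable k r W"
    by (intro add_mono max_colorable_ge fin colorable_geometric_graph_mono[OF U(2)]) auto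
  finally show "max_colorable k r (V \<union> W) \<le> max_colorable k r V + max_colorable k r W"
    using U by simp
  obtain A where A: "A \<subseteq> V" "colorable k (geometric_graph r A)" "card A = max_colorable k r V"
    using max_colorable_witness[OF fin(1)] .
  obtain B where B: "B \<subseteq> W" "colorable k (geometric_graph r B)" "card B = max_colorable k r W"
    using max_colorable_witness[OF fin(2)] .
  obtain a where a: "\<forall>v\<in>A. a v < k" "\<forall>u\<in>A. \<forall>v\<in>A. u \<noteq> v \<longrightarrow> norm (u - v) \<le> r \<longrightarrow> a u \<noteq> a v"
    using colorable_geometric_graphE[OF A(2)] .
  obtain b where b: "\<forall>v\<in>B. b v < k" "\<forall>u\<in>B. \<forall>v\<in>B. u \<noteq> v \<longrightarrow> norm (u - v) \<le> r \<longrightarrow> b u \<noteq> b v"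
    using colorable_geometric_graphE[OF B(2)] .
  have far': "r < norm (u - v)" "r < norm (v - u)" if "u \<in> A" "v \<in> B" for u v
    using far[of u v] that A(1) B(1) by (auto simp: norm_minus_commute)
  have "colorable k (geometric_graph r (A \<union> B))"
    unfolding colorable_geometric_graph
  proof (intro exI[of _ "\<lambda>v. if v \<in> A then a v else b v"] conjI ballI impI)
    fix u v assume "u \<in> A \<union> B" "v \<in> A \<union> B" "u \<noteq> v" "norm (u - v) \<le> r"
    then show "(if u \<in> A then a u else b u) \<noteq> (if v \<in> A then a v else b v)"
      using a(2) b(2) far'[of u v] far'[of v u] by (cases "u \<in> A"; cases "v \<in> A") auto
  qed (use a b in auto)
  then have "card (A \<union> B) \<le> max_colorable k r (V \<union> W)"
    using A(1) B(1) finU by (intro max_colorable_ge) auto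
  moreover have "card (A \<union> B) = card A + card B"
    using A(1) B(1) disj fin by (intro card_Un_disjoint) (auto intro: finite_subset)
  ultimately show "max_colorable k r V + max_colorable k r W \<le> max_colorable k r (V \<union> W)"
    using A(3) B(3) by simp
qed

text \<open>A proper coloring is injective on a clique, so at most \<open>k\<close> points are
  colored. Conversely, any enumeration of \<open>min k (card V)\<close> points is itself a
  coloring.\<close>

lemma max_colorable_clique:
  assumes fin: "finite V" and clique: "\<And>u v. u \<in> V \<Longrightarrow> v \<in> V \<Longrightarrow> norm (u - v) \<le> r"
  shows "max_colorable k r V = min k (card V)"
proof (rule antisym)
  obtain U where U: "U \<subseteq> V" "colorable k (geometric_graph r U)" "card U = max_colorable k r V"
    using max_colorable_witness[OF fin] .
  obtain c where c: "\<forall>v\<in>U. c v < k" "\<forall>u\<in>U. \<forall>v\<in>U. u \<noteq> v \<longrightarrow> norm (u - v) \<le> r \<longrightarrow> c u \<noteq> c v"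
    using colorable_geometric_graphE[OF U(2)] .
  have "inj_on c U" using c(2) U(1) clique by (meson inj_onI subsetD)
  then have "card U \<le> card {..<k}" using c(1) by (intro card_inj_on_le[of c]) auto
  then show "max_colorable k r V \<le> min k (card V)"
    using U max_colorable_le_card[OF fin, of k r] by simp
  obtain U where U: "U \<subseteq> V" "card U = min k (card V)" "finite U"
    by (rule obtain_subset_with_card_n[of "min k (card V)" V]) auto
  obtain c where c: "bij_betw c U {0..<card U}"
    using ex_bij_betw_finite_nat[OF U(3)] by blast
  have "colorable k (geometric_graph r U)"
    unfolding colorable_geometric_graph
    using c U(2) by (intro exI[of _ c]) (auto simp: bij_betw_def inj_on_def)
  then show "min k (card V) \<le> max_colorable k r V"
    using max_colorable_ge[OF fin U(1)] U(2) by metis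
qed

text \<open>The coloring is carried along the inverse of \<open>f\<close>; it stays proper because
  every edge between image points comes from an edge between their preimages. The thresholds
  \<open>r\<close> and \<open>s\<close> differ because rounding to a grid will call for a larger
  one.\<close>

lemma max_colorable_image_le:
  assumes fin: "finite V" and inj: "inj_on f V"
    and adj: "\<And>u v. u \<in> V \<Longrightarrow> v \<in> V \<Longrightarrow> norm (f u - f v) \<le> s \<Longrightarrow> norm (u - v) \<le> r"
  shows "max_colorable k r V \<le> max_colorable k s (f ` V)"
proof -
  obtain U where U: "U \<subseteq> V" "colorable k (geometric_graph r U)" "card U = max_colorable k r V"
    using max_colorable_witness[OF fin] .
  obtain c where c: "\<forall>v\<in>U. c v < k" "\<forall>u\<in>U. \<forall>v\<in>U. u \<noteq> v \<longrightarrow> norm (u - v) \<le> r \<longrightarrow> c u \<noteq> c v"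
    using colorable_geometric_graphE[OF U(2)] .
  have injU: "inj_on f U" using inj U(1) inj_on_subset by blast
  have "colorable k (geometric_graph s (f ` U))"
    unfolding colorable_geometric_graph
  proof (intro exI[of _ "c \<circ> the_inv_into U f"] conjI ballI impI)
    fix x y assume "x \<in> f ` U" "y \<in> f ` U" "x \<noteq> y" "norm (x - y) \<le> s"
    then obtain u v where "u \<in> U" "v \<in> U" "x = f u" "y = f v" "u \<noteq> v" "norm (u - v) \<le> r"
      using adj U(1) by blast
    then show "(c \<circ> the_inv_into U f) x \<noteq> (c \<circ> the_inv_into U f) y"
      using c(2) by (simp add: the_inv_into_f_f[OF injU])
  qed (use c(1) in \<open>auto simp: the_inv_into_f_f[OF injU]\<close>)
  then have "card (f ` U) \<le> max_colorable k s (f ` V)"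
    using fin U(1) by (intro max_colorable_ge) auto
  then show ?thesis using card_image[OF injU] U(3) by simp
qed

text \<open>The previous inequality is applied to \<open>f\<close> and to its inverse.\<close>

lemma max_colorable_image:
  assumes fin: "finite V" and inj: "inj_on f V"
    and adj: "\<And>u v. u \<in> V \<Longrightarrow> v \<in> V \<Longrightarrow> norm (f u - f v) \<le> s \<longleftrightarrow> norm (u - v) \<le> r"
  shows "max_colorable k s (f ` V) = max_colorable k r V"
proof (rule antisym)
  show "max_colorable k r V \<le> max_colorable k s (f ` V)"
    using assms by (intro max_colorable_image_le) auto
  have "max_colorable k s (f ` V) \<le> max_colorable k r (the_inv_into V f ` f ` V)"
    using assms by (intro max_colorable_image_le inj_on_the_inv_into)
      (auto simp: the_inv_into_f_f[OF inj])
  also have "the_inv_into V f ` f ` V = V"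
    by (auto simp: the_inv_into_f_f[OF inj] image_image)
  finally show "max_colorable k s (f ` V) \<le> max_colorable k r V" .
qed

subsection \<open>Grid approximation\<close>

text \<open>The mesh is \<open>1 / Suc n\<close>, so that it is well defined for
  \<open>n = 0\<close> too.\<close>

definition grid_round :: "nat \<Rightarrow> 'a::euclidean_space \<Rightarrow> 'a" where
  "grid_round n x = (\<Sum>b\<in>Basis. (of_int \<lfloor>real (Suc n) * (x \<bullet> b)\<rfloor> / real (Suc n)) *\<^sub>R b)"

text \<open>Each coordinate moves by at most one mesh width, and the Euclidean norm is at most the
  sum of the absolute coordinates.\<close>

lemma grid_round_error:
  fixes x :: "'a::euclidean_space"
  shows "norm (grid_round n x - x) \<le> real DIM('a) / real (Suc n)"
proof -
  have "\<bar>(grid_round n x - x) \<bullet> b\<bar> \<le> 1 / real (Suc n)" if b: "b \<in> Basis" for b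
  proof -
    let ?y = "real (Suc n) * (x \<bullet> b)"
    have "(grid_round n x - x) \<bullet> b = (of_int \<lfloor>?y\<rfloor> - ?y) / real (Suc n)"
      using b by (simp add: grid_round_def inner_diff_left field_simps)
    moreover have "\<bar>of_int \<lfloor>?y\<rfloor> - ?y\<bar> \<le> 1" by linarith
    ultimately show ?thesis by (simp add: divide_right_mono)
  qed
  then have "(\<Sum>b\<in>Basis. \<bar>(grid_round n x - x) \<bullet> b\<bar>) \<le> (\<Sum>b\<in>(Basis :: 'a set). 1 / real (Suc n))"
    by (intro sum_mono) auto
  then show ?thesis using norm_le_l1[of "grid_round n x - x"] by simp
qed

text \<open>This finiteness is what later reduces the functional on a bounded region to finitely
  many counts. On a bounded set the floors of the scaled coordinates are integers in a fixed
  interval \<open>{-K..K}\<close>.\<close>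

lemma finite_grid_round_image:
  fixes R :: "'a::euclidean_space set"
  assumes "bounded R"
  shows "finite (grid_round n ` R)"
proof -
  obtain B where B: "\<And>x. x \<in> R \<Longrightarrow> norm x \<le> B" using assms unfolding bounded_iff by blast
  define K where "K = \<lceil>real (Suc n) * B\<rceil>"
  define F where "F = PiE (Basis :: 'a set) (\<lambda>_. {-K..K})"
  have "finite F" unfolding F_def by (intro finite_PiE) auto
  moreover have "grid_round n ` R \<subseteq> (\<lambda>f. \<Sum>b\<in>Basis. (of_int (f b) / real (Suc n)) *\<^sub>R b) ` F"
  proof
    fix y assume "y \<in> grid_round n ` R"
    then obtain x where x: "x \<in> R" "y = grid_round n x" by blast
    have "\<lfloor>real (Suc n) * (x \<bullet> b)\<rfloor> \<in> {-K..K}" if "b \<in> Basis" for b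
    proof -
      have "\<bar>x \<bullet> b\<bar> \<le> B" using Basis_le_norm[OF that, of x] B[OF x(1)] by linarith
      then have "\<bar>real (Suc n) * (x \<bullet> b)\<bar> \<le> real (Suc n) * B"
        by (simp add: abs_mult mult_left_mono)
      then show ?thesis unfolding K_def by (simp del: of_nat_Suc) linarith
    qed
    then have "(\<lambda>b\<in>Basis. \<lfloor>real (Suc n) * (x \<bullet> b)\<rfloor>) \<in> F" by (auto simp: F_def)
    then show "y \<in> (\<lambda>f. \<Sum>b\<in>Basis. (of_int (f b) / real (Suc n)) *\<^sub>R b) ` F"
      by (intro image_eqI) (auto simp: x(2) grid_round_def)
  qed
  ultimately show ?thesis using finite_subset by blast
qed

lemma borel_measurable_grid_round [measurable]: "grid_round n \<in> borel_measurable borel"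
  unfolding grid_round_def by measurable

lemma grid_round_tendsto: "(\<lambda>n. grid_round n x) \<longlonglongrightarrow> (x :: 'a::euclidean_space)"
proof -
  have "(\<lambda>n. real DIM('a) / real (Suc n)) \<longlonglongrightarrow> 0"
    by (rule LIMSEQ_Suc[OF lim_const_over_n])
  then have "(\<lambda>n. grid_round n x - x) \<longlonglongrightarrow> 0"
    by (rule Lim_null_comparison[OF always_eventually, rotated]) (intro allI grid_round_error)
  then show ?thesis by (rule LIM_zero_cancel)
qed

text \<open>The threshold is raised by the rounding error of the two endpoints.\<close>

definition grid_max_colorable :: "nat \<Rightarrow> nat \<Rightarrow> 'a::euclidean_space set \<Rightarrow> nat" where
  "grid_max_colorable k n V =
    max_colorable k (1 + 2 * (real DIM('a) / real (Suc n))) (grid_round n ` V)"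

text \<open>There are finitely many pairs of points, so it suffices that each pair is eventually
  kept distinct and keeps its adjacency. Rounding could push a pair at distance exactly 1 apart,
  which the raised threshold absorbs; a pair at distance above 1 has a positive gap that eventually
  exceeds the vanishing excess of the threshold.\<close>

lemma eventually_grid_max_colorable:
  fixes V :: "'a::euclidean_space set"
  assumes "finite V"
  shows "\<forall>\<^sub>F n in sequentially. grid_max_colorable k n V = max_colorable k 1 V"
proof -
  let ?\<delta> = "\<lambda>n. real DIM('a) / real (Suc n)"
  have \<delta>: "?\<delta> \<longlonglongrightarrow> 0"
    by (rule LIMSEQ_Suc[OF lim_const_over_n])
  have 1: "\<forall>\<^sub>F n in sequentially. u \<noteq> v \<longrightarrow> grid_round n u \<noteq> grid_round n v" for u v :: 'a
  proof (cases "u = v")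
    case False
    have "(\<lambda>n. grid_round n u - grid_round n v) \<longlonglongrightarrow> u - v"
      by (intro tendsto_diff grid_round_tendsto)
    then have "\<forall>\<^sub>F n in sequentially. grid_round n u - grid_round n v \<noteq> 0"
      by (rule tendsto_imp_eventually_ne) (use False in auto)
    then show ?thesis by eventually_elim auto
  qed auto
  have 2: "\<forall>\<^sub>F n in sequentially.
      norm (grid_round n u - grid_round n v) \<le> 1 + 2 * ?\<delta> n \<longleftrightarrow> norm (u - v) \<le> 1" for u v :: 'a
  proof (cases "norm (u - v) \<le> 1")
    case True
    have "norm (grid_round n u - grid_round n v) \<le> 1 + 2 * ?\<delta> n" for n
    proof -
      define a b e where "a = grid_round n u - u" and "b = grid_round n v - v" and "e = ?\<delta> n"
      have "grid_round n u - grid_round n v = (a + (u - v)) - b" by (simp add: a_def b_def)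
      moreover have "norm ((a + (u - v)) - b) \<le> norm a + norm (u - v) + norm b"
        using norm_triangle_ineq[of a "u - v"] norm_triangle_ineq4[of "a + (u - v)" b] by linarith
      moreover have "norm a \<le> e" "norm b \<le> e"
        unfolding a_def b_def e_def by (rule grid_round_error)+
      ultimately have "norm (grid_round n u - grid_round n v) \<le> 1 + 2 * e" using True by simp
      then show ?thesis unfolding e_def .
    qed
    with True show ?thesis by simp
  next
    case False
    have "(\<lambda>n. norm (grid_round n u - grid_round n v) - (1 + 2 * ?\<delta> n))
        \<longlonglongrightarrow> norm (u - v) - (1 + 2 * 0)"
      by (intro tendsto_intros grid_round_tendsto \<delta>)
    then have "\<forall>\<^sub>F n in sequentially. norm (grid_round n u - grid_round n v) - (1 + 2 * ?\<delta> n) > 0"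
      by (rule order_tendstoD) (use False in auto)
    then show ?thesis using False by (auto elim: eventually_mono)
  qed
  have "\<forall>\<^sub>F n in sequentially. \<forall>p\<in>V \<times> V.
      (fst p \<noteq> snd p \<longrightarrow> grid_round n (fst p) \<noteq> grid_round n (snd p)) \<and>
      (norm (grid_round n (fst p) - grid_round n (snd p)) \<le> 1 + 2 * ?\<delta> n \<longleftrightarrow> norm (fst p - snd p) \<le> 1)"
    using assms by (intro eventually_ball_finite ballI eventually_conj 1 2) auto
  then show ?thesis
  proof eventually_elim
    case (elim n)
    show ?case unfolding grid_max_colorable_def
      using elim assms by (intro max_colorable_image) (auto simp: inj_on_def)
  qed
qed

lemma grid_max_colorable_le_card: "finite V \<Longrightarrow> grid_max_colorable k n V \<le> card V"
  unfolding grid_max_colorable_def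
  by (meson card_image_le finite_imageI max_colorable_le_card order_trans)

subsection \<open>Moments and a variance bound\<close>

text \<open>Since \<open>n\<close> is at most \<open>2 ^ n\<close>, the square is at most
  \<open>4 ^ n\<close>, and the exponential series at \<open>4 * m\<close> dominates.\<close>

lemma summable_square_poisson_weights:
  fixes m :: real
  assumes "0 \<le> m"
  shows "summable (\<lambda>n. (real n)\<^sup>2 * (m ^ n / fact n))"
proof (rule summable_comparison_test')
  show "summable (\<lambda>n. inverse (fact n) * (4 * m) ^ n)" by (rule summable_exp)
  fix n :: nat
  have "real n \<le> 2 ^ n" using of_nat_less_two_power[of n, where 'a=real] by simp
  then have "(real n)\<^sup>2 \<le> (2 ^ n)\<^sup>2" by (rule power_mono) simp
  also have "\<dots> = (4 :: real) ^ n" by (simp add: power_mult[symmetric] mult.commute[of n] power_mult)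
  finally have "(real n)\<^sup>2 * (m ^ n / fact n) \<le> 4 ^ n * (m ^ n / fact n)"
    using assms by (intro mult_right_mono) auto
  then show "norm ((real n)\<^sup>2 * (m ^ n / fact n)) \<le> inverse (fact n) * (4 * m) ^ n"
    using assms by (simp add: power_mult_distrib field_simps)
qed

lemma integrable_square_poisson_law:
  assumes "0 \<le> m"
  shows "integrable (measure_pmf (poisson_law m)) (\<lambda>n. (real n)\<^sup>2)"
proof (cases "m > 0")
  case True
  have "summable (\<lambda>n. norm (pmf (poisson_pmf m) n *\<^sub>R (real n)\<^sup>2))"
    using summable_mult[OF summable_square_poisson_weights[OF assms], of "exp (- m)"] True
    by (simp add: mult_ac)
  then have "integrable (measure_pmf (poisson_pmf m)) (\<lambda>n. (real n)\<^sup>2)"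
    unfolding measure_pmf_eq_density
    by (subst integrable_density) (auto simp: integrable_count_space_nat_iff)
  with True show ?thesis by (simp add: poisson_law_def)
qed (auto simp: poisson_law_def intro: integrable_measure_pmf_finite)

lemma pmf_poisson_law_0_pos: "0 \<le> m \<Longrightarrow> 0 < pmf (poisson_law m) 0"
  by (simp add: poisson_law_def)

lemma integrable_measure_pmf_bounded:
  fixes f :: "'a \<Rightarrow> real"
  assumes "\<And>x. \<bar>f x\<bar> \<le> B"
  shows "integrable (measure_pmf p) f"
  using assms by (intro measure_pmf.integrable_const_bound[where B = B]) auto

text \<open>A vanishing expectation would make \<open>min k n\<close> equal to \<open>a\<close> for
  every \<open>n\<close> of positive mass, hence for all \<open>n\<close>. But
  \<open>min k n\<close> is 0 at \<open>n = 0\<close> and 1 at \<open>n = 1\<close>, as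
  \<open>k\<close> is at least 1.\<close>

lemma expectation_poisson_law_truncated_pos:
  assumes m: "0 < m" and k: "1 \<le> (k :: nat)"
  shows "0 < measure_pmf.expectation (poisson_law m) (\<lambda>n. (real (min k n) - a)\<^sup>2)"
proof -
  let ?p = "poisson_pmf m"
  let ?f = "\<lambda>n. (real (min k n) - a)\<^sup>2"
  have int: "integrable (measure_pmf ?p) ?f"
  proof (rule integrable_measure_pmf_bounded)
    fix n
    have "\<bar>real (min k n) - a\<bar> \<le> real k + \<bar>a\<bar>" by auto
    then show "\<bar>?f n\<bar> \<le> (real k + \<bar>a\<bar>)\<^sup>2" using power_mono[of "\<bar>real (min k n) - a\<bar>" _ 2] by simp
  qed
  have "measure_pmf.expectation ?p ?f \<noteq> 0"
  proof
    assume "measure_pmf.expectation ?p ?f = 0"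
    then have "AE n in measure_pmf ?p. ?f n = 0"
      using integral_nonneg_eq_0_iff_AE[OF int] by simp
    then have "?f n = 0" for n using m by (simp add: AE_measure_pmf_iff)
    from this[of 0] this[of 1] show False using k by simp
  qed
  moreover have "measure_pmf.expectation ?p ?f \<ge> 0" by simp
  ultimately have "0 < measure_pmf.expectation ?p ?f" by linarith
  then show ?thesis using m by (simp add: poisson_law_def)
qed

section \<open>A Bessel-type lower bound for the variance\<close>

lemma integrable_mult_bounded:
  fixes f g :: "'a \<Rightarrow> real"
  assumes f: "integrable M f" and g: "g \<in> borel_measurable M" "\<And>x. \<bar>g x\<bar> \<le> B"
  shows "integrable M (\<lambda>x. f x * g x)"
proof (rule Bochner_Integration.integrable_bound)
  show "integrable M (\<lambda>x. B * f x)" using f by simp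
  have "0 \<le> B" using g(2) abs_ge_zero order_trans by blast
  then have "\<bar>f x * g x\<bar> \<le> \<bar>B * f x\<bar>" for x
    using mult_left_mono[OF g(2), of "\<bar>f x\<bar>"] by (simp add: abs_mult mult.commute)
  then show "AE x in M. norm (f x * g x) \<le> norm (B * f x)" by simp
qed (use f g in measurable)

text \<open>This is Bessel's inequality for the orthogonal family \<open>Z\<close>. As
  \<open>E (F Z)\<close> and \<open>E (Z^2)\<close> are the same number \<open>s\<close>, all
  projection coefficients are 1 when \<open>s\<close> is nonzero, and the plain sum of the
  \<open>Z i\<close> is the projection.\<close>

lemma (in prob_space) variance_ge_sum_orthogonal:
  fixes F :: "'a \<Rightarrow> real" and Z :: "'i \<Rightarrow> 'a \<Rightarrow> real"
  assumes F: "integrable M F" "integrable M (\<lambda>\<omega>. (F \<omega>)\<^sup>2)"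
    and I: "finite I"
    and meas: "\<And>i. i \<in> I \<Longrightarrow> Z i \<in> borel_measurable M"
    and bounded: "\<And>i \<omega>. i \<in> I \<Longrightarrow> \<bar>Z i \<omega>\<bar> \<le> B"
    and centered: "\<And>i. i \<in> I \<Longrightarrow> expectation (Z i) = 0"
    and orthogonal: "\<And>i j. i \<in> I \<Longrightarrow> j \<in> I \<Longrightarrow> i \<noteq> j \<Longrightarrow> expectation (\<lambda>\<omega>. Z i \<omega> * Z j \<omega>) = 0"
    and square: "\<And>i. i \<in> I \<Longrightarrow> expectation (\<lambda>\<omega>. Z i \<omega> * Z i \<omega>) = s"
    and cross: "\<And>i. i \<in> I \<Longrightarrow> expectation (\<lambda>\<omega>. F \<omega> * Z i \<omega>) = s"
  shows "real (card I) * s \<le> variance F"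
proof -
  define e where "e = expectation F"
  define S where "S = (\<lambda>\<omega>. \<Sum>i\<in>I. Z i \<omega>)"
  have intZ: "integrable M (Z i)" if "i \<in> I" for i
    using meas[OF that] bounded[OF that] by (intro integrable_const_bound[where B = B]) auto
  have intFZ: "integrable M (\<lambda>\<omega>. F \<omega> * Z i \<omega>)" if "i \<in> I" for i
    using F meas[OF that] bounded[OF that]
    by (intro integrable_mult_bounded) auto
  have intZZ: "integrable M (\<lambda>\<omega>. Z i \<omega> * Z j \<omega>)" if "i \<in> I" "j \<in> I" for i j
    using intZ[OF that(1)] meas[OF that(2)] bounded[OF that(2)]
    by (intro integrable_mult_bounded) auto
  have intS: "integrable M S" unfolding S_def by (intro Bochner_Integration.integrable_sum intZ)
  have FS: "(\<lambda>\<omega>. F \<omega> * S \<omega>) = (\<lambda>\<omega>. \<Sum>i\<in>I. F \<omega> * Z i \<omega>)"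
    by (simp add: S_def sum_distrib_left)
  have SS: "(\<lambda>\<omega>. (S \<omega>)\<^sup>2) = (\<lambda>\<omega>. \<Sum>i\<in>I. \<Sum>j\<in>I. Z i \<omega> * Z j \<omega>)"
    by (simp add: S_def power2_eq_square sum_product)
  have intFS: "integrable M (\<lambda>\<omega>. F \<omega> * S \<omega>)"
    unfolding FS by (intro Bochner_Integration.integrable_sum intFZ)
  have intSS: "integrable M (\<lambda>\<omega>. (S \<omega>)\<^sup>2)"
    unfolding SS by (intro Bochner_Integration.integrable_sum intZZ)
  have ES: "expectation S = 0"
    unfolding S_def by (subst Bochner_Integration.integral_sum) (auto simp: intZ centered)
  have EFS: "expectation (\<lambda>\<omega>. F \<omega> * S \<omega>) = real (card I) * s"
    unfolding FS by (subst Bochner_Integration.integral_sum) (auto simp: intFZ cross)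
  have "expectation (\<lambda>\<omega>. (S \<omega>)\<^sup>2) = (\<Sum>i\<in>I. \<Sum>j\<in>I. expectation (\<lambda>\<omega>. Z i \<omega> * Z j \<omega>))"
    unfolding SS
    by (subst Bochner_Integration.integral_sum, auto intro!: Bochner_Integration.integrable_sum intZZ)
      (intro sum.cong refl, subst Bochner_Integration.integral_sum, auto intro!: intZZ)
  also have "\<dots> = (\<Sum>i\<in>I. \<Sum>j\<in>I. if i = j then s else 0)"
    by (intro sum.cong refl) (auto simp: orthogonal square)
  also have "\<dots> = real (card I) * s" using I by simp
  finally have ESS: "expectation (\<lambda>\<omega>. (S \<omega>)\<^sup>2) = real (card I) * s" .
  have intV: "integrable M (\<lambda>\<omega>. (F \<omega> - e)\<^sup>2)"
    using F by (simp add: power2_diff)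
  \<comment> \<open>The cross term contributes \<open>-2\<close> times \<open>card I * s\<close> and
    the square of the sum contributes it once; the term with \<open>e\<close> vanishes because the
    sum is centered.\<close>
  have "0 \<le> expectation (\<lambda>\<omega>. (F \<omega> - e - S \<omega>)\<^sup>2)" by simp
  also have "(\<lambda>\<omega>. (F \<omega> - e - S \<omega>)\<^sup>2) =
      (\<lambda>\<omega>. (F \<omega> - e)\<^sup>2 - 2 * (F \<omega> * S \<omega>) + 2 * e * S \<omega> + (S \<omega>)\<^sup>2)"
    by (simp add: power2_eq_square algebra_simps)
  also have "expectation \<dots> = expectation (\<lambda>\<omega>. (F \<omega> - e)\<^sup>2) - real (card I) * s"
    using intV intFS intS intSS by (simp add: EFS ES ESS)
  finally show ?thesis by (simp add: e_def)
qed

subsection \<open>Independence for functionals of a Poisson process\<close>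

context poisson_process
begin

abbreviation count :: "'a set \<Rightarrow> 'w \<Rightarrow> nat" where
  "count A \<omega> \<equiv> card (X \<omega> \<inter> A)"

lemma expectation_count:
  fixes f :: "nat \<Rightarrow> real"
  assumes "A \<in> sets borel" "bounded A"
  shows "expectation (\<lambda>\<omega>. f (count A \<omega>)) =
    measure_pmf.expectation (poisson_law (intensity * measure lborel A)) f"
  unfolding count_law[OF assms, symmetric]
  by (rule integral_distr[OF count_measurable[OF assms], symmetric]) simp

lemma integrable_count_iff:
  fixes f :: "nat \<Rightarrow> real"
  assumes "A \<in> sets borel" "bounded A"
  shows "integrable M (\<lambda>\<omega>. f (count A \<omega>)) \<longleftrightarrow>
    integrable (measure_pmf (poisson_law (intensity * measure lborel A))) f"
  unfolding count_law[OF assms, symmetric]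
  by (rule integrable_distr_eq[OF count_measurable[OF assms], symmetric]) simp

lemma borel_measurable_count:
  fixes f :: "nat \<Rightarrow> real"
  assumes "A \<in> sets borel" "bounded A"
  shows "(\<lambda>\<omega>. f (count A \<omega>)) \<in> borel_measurable M"
  by (rule measurable_compose[OF count_measurable[OF assms]]) simp

lemma integrable_count_square:
  assumes "A \<in> sets borel" "bounded A"
  shows "integrable M (\<lambda>\<omega>. (real (count A \<omega>))\<^sup>2)"
  using integrable_count_iff[OF assms, of "\<lambda>n. (real n)\<^sup>2"] intensity_pos
  by (simp add: integrable_square_poisson_law)

lemma integrable_count:
  assumes "A \<in> sets borel" "bounded A"
  shows "integrable M (\<lambda>\<omega>. real (count A \<omega>))"
  by (rule square_integrable_imp_integrable[OF borel_measurable_count[OF assms]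
        integrable_count_square[OF assms]])

lemma expectation_prod_count:
  fixes f :: "nat \<Rightarrow> nat \<Rightarrow> real"
  assumes A: "\<And>i. i < n \<Longrightarrow> A i \<in> sets borel \<and> bounded (A i)" "disjoint_family_on A {..<n}"
    and bounded: "\<And>i x. i < n \<Longrightarrow> \<bar>f i x\<bar> \<le> B"
  shows "expectation (\<lambda>\<omega>. \<Prod>i<n. f i (count (A i) \<omega>)) =
    (\<Prod>i<n. expectation (\<lambda>\<omega>. f i (count (A i) \<omega>)))"
proof (rule indep_vars_lebesgue_integral)
  show "indep_vars (\<lambda>_. borel) (\<lambda>i \<omega>. f i (count (A i) \<omega>)) {..<n}"
    by (rule indep_vars_compose2[OF count_indep[OF A]]) auto
  show "integrable M (\<lambda>\<omega>. f i (count (A i) \<omega>))" if "i \<in> {..<n}" for i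
    using that A(1)[of i] bounded[of i] integrable_count_iff[of "A i" "f i"]
    by (auto intro!: integrable_measure_pmf_bounded)
qed simp

text \<open>Rounding to a grid turns the functional of the points in \<open>R\<close> into a function of
  finitely many counts, so that the finite-dimensional independence of the counts applies.\<close>

lemma grid_max_colorable_indep:
  fixes p q :: "nat \<Rightarrow> real" and C D R :: "'a set" and k n :: nat
  assumes sets: "R \<in> sets borel" "bounded R" "C \<in> sets borel" "bounded C" "D \<in> sets borel" "bounded D"
    and disj: "R \<inter> C = {}" "R \<inter> D = {}" "C \<inter> D = {}"
    and bounded: "\<And>x. \<bar>p x\<bar> \<le> B" "\<And>x. \<bar>q x\<bar> \<le> B"
  defines "G \<equiv> \<lambda>\<omega>. real (grid_max_colorable k n (X \<omega> \<inter> R))"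
  shows "G \<in> borel_measurable M"
    and "expectation (\<lambda>\<omega>. G \<omega> * (p (count C \<omega>) * q (count D \<omega>))) =
      expectation G * expectation (\<lambda>\<omega>. p (count C \<omega>) * q (count D \<omega>))"
proof -
  let ?r = "1 + 2 * (real DIM('a) / real (Suc n))"
  let ?P = "grid_round n ` R"
  define m where "m = card ?P"
  obtain g where g: "bij_betw g {0..<m} ?P"
    unfolding m_def using ex_bij_betw_nat_finite[OF finite_grid_round_image[OF sets(2)]] by blast
  \<comment> \<open>The indices below \<open>m\<close> are the cells of \<open>R\<close> over the
    grid points; \<open>m\<close> and \<open>Suc m\<close> are reserved for \<open>C\<close> and
    \<open>D\<close>. One disjoint family thus carries all the counts.\<close>
  define A where "A = (\<lambda>i. if i < m then R \<inter> grid_round n -` {g i} else if i = m then C else D)"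
  have A_sets: "A i \<in> sets borel \<and> bounded (A i)" for i
  proof -
    have "grid_round n -` {g i} \<inter> space borel \<in> sets borel"
      by (intro measurable_sets[OF borel_measurable_grid_round]) auto
    then show ?thesis using sets by (auto simp: A_def intro: bounded_subset)
  qed
  have g_inj: "g i = g j \<Longrightarrow> i = j" if "i < m" "j < m" for i j
    using g that unfolding bij_betw_def inj_on_def by auto
  have "disjoint_family_on A {..<Suc (Suc m)}"
    using disj by (auto simp: disjoint_family_on_def A_def split: if_splits dest: g_inj)
  then have indep: "indep_vars (\<lambda>_. count_space UNIV) (\<lambda>i. count (A i)) {..<Suc (Suc m)}"
    using A_sets by (intro count_indep)
  have indep2: "indep_var
      (PiM {..<m} (\<lambda>_. count_space UNIV)) (\<lambda>\<omega>. \<lambda>i\<in>{..<m}. count (A i) \<omega>)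
      (PiM {m, Suc m} (\<lambda>_. count_space UNIV)) (\<lambda>\<omega>. \<lambda>i\<in>{m, Suc m}. count (A i) \<omega>)"
    by (rule indep_var_restrict[OF indep]) auto
  \<comment> \<open>\<open>S\<close> selects the occupied cells. Occupancy is enough, since the
    image under rounding is a set and forgets multiplicities.\<close>
  define S where "S = (\<lambda>f :: nat \<Rightarrow> nat. {i\<in>{..<m}. 0 < f i})"
  \<comment> \<open>The target is finite, so only preimages of single index sets have to be
    measurable.\<close>
  have "S \<in> measurable (PiM {..<m} (\<lambda>_. count_space UNIV)) (count_space (Pow {..<m}))"
    unfolding measurable_count_space_eq2[OF finite_Pow_iff[THEN iffD2, OF finite_lessThan]]
  proof (intro conjI ballI)
    fix T assume "T \<in> Pow {..<m}"
    then have "S -` {T} \<inter> space (PiM {..<m} (\<lambda>_. count_space UNIV)) =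
        {f \<in> space (PiM {..<m} (\<lambda>_. count_space UNIV)). \<forall>i\<in>{..<m}. 0 < f i \<longleftrightarrow> i \<in> T}"
      by (auto simp: S_def)
    also have "\<dots> \<in> sets (PiM {..<m} (\<lambda>_. count_space UNIV))" by measurable
    finally show "S -` {T} \<inter> space (PiM {..<m} (\<lambda>_. count_space UNIV)) \<in>
      sets (PiM {..<m} (\<lambda>_. count_space UNIV))" .
  qed (auto simp: S_def)
  then have Y1: "(\<lambda>f. real (max_colorable k ?r (g ` S f)))
      \<in> borel_measurable (PiM {..<m} (\<lambda>_. count_space UNIV))"
    by (rule measurable_compose) simp
  have Y2: "(\<lambda>f. p (f m) * q (f (Suc m)))
      \<in> borel_measurable (PiM {m, Suc m} (\<lambda>_. count_space UNIV))"
  proof (intro borel_measurable_times)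
    show "(\<lambda>f. p (f m)) \<in> borel_measurable (PiM {m, Suc m} (\<lambda>_. count_space UNIV))"
      by (rule measurable_compose[OF measurable_component_singleton]) auto
    show "(\<lambda>f. q (f (Suc m))) \<in> borel_measurable (PiM {m, Suc m} (\<lambda>_. count_space UNIV))"
      by (rule measurable_compose[OF measurable_component_singleton]) auto
  qed
  define H where "H = (\<lambda>f. real (max_colorable k ?r (g ` S f))) \<circ> (\<lambda>\<omega>. \<lambda>i\<in>{..<m}. count (A i) \<omega>)"
  define W where "W = (\<lambda>\<omega>. p (count C \<omega>) * q (count D \<omega>))"
  have W_eq: "W = (\<lambda>f. p (f m) * q (f (Suc m))) \<circ> (\<lambda>\<omega>. \<lambda>i\<in>{m, Suc m}. count (A i) \<omega>)"
    by (auto simp: W_def A_def)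
  have HW: "indep_var borel H borel W"
    unfolding H_def W_eq by (rule indep_var_compose[OF indep2 Y1 Y2])
  \<comment> \<open>Local finiteness holds on \<open>space M\<close>, and it rules out an infinite
    cell, whose \<open>card\<close> would be 0. The equality is therefore claimed there only and is
    transferred by congruence below.\<close>
  have GH: "G \<omega> = H \<omega>" if \<omega>: "\<omega> \<in> space M" for \<omega>
  proof -
    have pos: "0 < count (A i) \<omega> \<longleftrightarrow> X \<omega> \<inter> A i \<noteq> {}" for i
      using locally_finite[OF \<omega>, of "A i"] A_sets[of i] by (simp add: card_gt_0_iff)
    have "grid_round n ` (X \<omega> \<inter> R) = g ` {i\<in>{..<m}. X \<omega> \<inter> A i \<noteq> {}}"
    proof (intro set_eqI iffI)
      fix y assume "y \<in> grid_round n ` (X \<omega> \<inter> R)"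
      then obtain x where x: "x \<in> X \<omega>" "x \<in> R" "y = grid_round n x" by blast
      then have "y \<in> g ` {0..<m}" using g by (auto simp: bij_betw_def)
      then obtain i where "i < m" "y = g i" by auto
      then show "y \<in> g ` {i\<in>{..<m}. X \<omega> \<inter> A i \<noteq> {}}" using x by (auto simp: A_def)
    next
      fix y assume "y \<in> g ` {i\<in>{..<m}. X \<omega> \<inter> A i \<noteq> {}}"
      then obtain i x where "i < m" "y = g i" "x \<in> X \<omega>" "x \<in> A i" by blast
      then show "y \<in> grid_round n ` (X \<omega> \<inter> R)" by (intro image_eqI[of _ _ x]) (auto simp: A_def)
    qed
    also have "\<dots> = g ` S (\<lambda>i\<in>{..<m}. count (A i) \<omega>)" unfolding S_def
      by (rule arg_cong[of _ _ "(`) g"]) (auto simp: pos[symmetric])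
    finally show ?thesis by (simp add: G_def H_def grid_max_colorable_def)
  qed
  have H_meas: "H \<in> borel_measurable M" using indep_var_rv1[OF HW] .
  then show "G \<in> borel_measurable M" using measurable_cong[of M G H borel] GH by blast
  have "integrable M H"
  \<comment> \<open>The total count in \<open>R\<close> dominates, because no more points can be
    colored than there are.\<close>
  proof (rule Bochner_Integration.integrable_bound[OF integrable_count[OF sets(1,2)] H_meas])
    show "AE \<omega> in M. norm (H \<omega>) \<le> norm (real (count R \<omega>))"
      using GH locally_finite[OF _ sets(2)]
      by (intro AE_I2) (simp add: GH[symmetric] G_def grid_max_colorable_le_card)
  qed
  moreover have "integrable M W"
  proof (rule integrable_const_bound)
    show "AE \<omega> in M. norm (W \<omega>) \<le> B * B"
      using bounded by (intro AE_I2) (auto simp: W_def abs_mult intro!: mult_mono' )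
  qed (rule indep_var_rv2[OF HW])
  ultimately have "expectation (\<lambda>\<omega>. H \<omega> * W \<omega>) = expectation H * expectation W"
    by (rule indep_var_lebesgue_integral[OF HW])
  moreover have "expectation (\<lambda>\<omega>. G \<omega> * W \<omega>) = expectation (\<lambda>\<omega>. H \<omega> * W \<omega>)"
    by (rule Bochner_Integration.integral_cong) (auto simp: GH)
  moreover have "expectation G = expectation H"
    by (rule Bochner_Integration.integral_cong) (auto simp: GH)
  ultimately show "expectation (\<lambda>\<omega>. G \<omega> * (p (count C \<omega>) * q (count D \<omega>))) =
      expectation G * expectation (\<lambda>\<omega>. p (count C \<omega>) * q (count D \<omega>))"
    by (simp add: W_def)
qed

section \<open>From the grid approximations to the functional itself\<close>

lemma grid_max_colorable_tendsto:
  assumes "bounded R" "\<omega> \<in> space M"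
  shows "(\<lambda>n. real (grid_max_colorable k n (X \<omega> \<inter> R))) \<longlonglongrightarrow> real (max_colorable k 1 (X \<omega> \<inter> R))"
  by (intro tendsto_eventually
      eventually_mono[OF eventually_grid_max_colorable[OF locally_finite[OF assms(2,1)]]]) simp

lemma borel_measurable_max_colorable:
  assumes "R \<in> sets borel" "bounded R"
  shows "(\<lambda>\<omega>. real (max_colorable k 1 (X \<omega> \<inter> R))) \<in> borel_measurable M"
proof (rule borel_measurable_LIMSEQ_real)
  show "(\<lambda>\<omega>. real (grid_max_colorable k n (X \<omega> \<inter> R))) \<in> borel_measurable M" for n
    \<comment> \<open>Only the measurability is wanted here, so the two further regions are empty
      and the test functions zero.\<close>
    using grid_max_colorable_indep(1)[of R "{}" "{}" "\<lambda>_. 0" 0 "\<lambda>_. 0"] assms by simp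
qed (rule grid_max_colorable_tendsto[OF assms(2)])

lemma integrable_max_colorable:
  assumes R: "R \<in> sets borel" "bounded R"
  shows "integrable M (\<lambda>\<omega>. real (max_colorable k 1 (X \<omega> \<inter> R)))"
    and "integrable M (\<lambda>\<omega>. (real (max_colorable k 1 (X \<omega> \<inter> R)))\<^sup>2)"
proof -
  have le: "max_colorable k 1 (X \<omega> \<inter> R) \<le> count R \<omega>" if "\<omega> \<in> space M" for \<omega>
    by (rule max_colorable_le_card[OF locally_finite[OF that R(2)]])
  show "integrable M (\<lambda>\<omega>. real (max_colorable k 1 (X \<omega> \<inter> R)))"
    by (rule Bochner_Integration.integrable_bound[OF integrable_count[OF R]
          borel_measurable_max_colorable[OF R]]) (auto intro!: AE_I2 le)
  show "integrable M (\<lambda>\<omega>. (real (max_colorable k 1 (X \<omega> \<inter> R)))\<^sup>2)"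
    by (rule Bochner_Integration.integrable_bound[OF integrable_count_square[OF R]
          borel_measurable_power[OF borel_measurable_max_colorable[OF R]]])
      (auto intro!: AE_I2 power_mono le)
qed

text \<open>The factorization holds at every grid level and passes to the limit by dominated
  convergence. The dominating function is the count in \<open>R\<close> times \<open>B * B\<close>,
  which is where the bounds on \<open>p\<close> and \<open>q\<close> enter.\<close>

lemma max_colorable_indep:
  fixes p q :: "nat \<Rightarrow> real" and C D R :: "'a set" and k :: nat
  assumes sets: "R \<in> sets borel" "bounded R" "C \<in> sets borel" "bounded C" "D \<in> sets borel" "bounded D"
    and disj: "R \<inter> C = {}" "R \<inter> D = {}" "C \<inter> D = {}"
    and bounded: "\<And>x. \<bar>p x\<bar> \<le> B" "\<And>x. \<bar>q x\<bar> \<le> B"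
  defines "G \<equiv> \<lambda>\<omega>. real (max_colorable k 1 (X \<omega> \<inter> R))"
  shows "expectation (\<lambda>\<omega>. G \<omega> * (p (count C \<omega>) * q (count D \<omega>))) =
      expectation G * expectation (\<lambda>\<omega>. p (count C \<omega>) * q (count D \<omega>))"
proof -
  define W where "W = (\<lambda>\<omega>. p (count C \<omega>) * q (count D \<omega>))"
  define H where "H = (\<lambda>n \<omega>. real (grid_max_colorable k n (X \<omega> \<inter> R)))"
  note grid = grid_max_colorable_indep[OF sets disj bounded, where k = k, folded H_def W_def]
  have W_meas: "W \<in> borel_measurable M" unfolding W_def
    using sets by (intro borel_measurable_times borel_measurable_count)
  have W_bound: "\<bar>W \<omega>\<bar> \<le> B * B" for \<omega>
    using bounded by (auto simp: W_def abs_mult intro!: mult_mono')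
  have H_meas: "H n \<in> borel_measurable M" for n using grid(1) by (simp add: H_def)
  have H_bound: "\<bar>H n \<omega>\<bar> \<le> real (count R \<omega>)" if "\<omega> \<in> space M" for n \<omega>
    unfolding H_def using grid_max_colorable_le_card[OF locally_finite[OF that sets(2)]] by simp
  have G_meas: "G \<in> borel_measurable M"
    unfolding G_def by (rule borel_measurable_max_colorable[OF sets(1,2)])
  have lim: "(\<lambda>n. H n \<omega>) \<longlonglongrightarrow> G \<omega>" if "\<omega> \<in> space M" for \<omega>
    unfolding H_def G_def by (rule grid_max_colorable_tendsto[OF sets(2) that])
  have "(\<lambda>n. expectation (H n)) \<longlonglongrightarrow> expectation G"
    by (rule integral_dominated_convergence[OF G_meas H_meas integrable_count[OF sets(1,2)]])
      (auto intro!: AE_I2 lim H_bound)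
  then have "(\<lambda>n. expectation (H n) * expectation W) \<longlonglongrightarrow> expectation G * expectation W"
    by (intro tendsto_intros)
  moreover have "(\<lambda>n. expectation (\<lambda>\<omega>. H n \<omega> * W \<omega>)) \<longlonglongrightarrow> expectation (\<lambda>\<omega>. G \<omega> * W \<omega>)"
  proof (rule integral_dominated_convergence)
    show "integrable M (\<lambda>\<omega>. real (count R \<omega>) * (B * B))"
      using integrable_count[OF sets(1,2)] by simp
    show "AE \<omega> in M. norm (H n \<omega> * W \<omega>) \<le> real (count R \<omega>) * (B * B)" for n
      using H_bound W_bound by (intro AE_I2) (auto simp: abs_mult intro!: mult_mono')
    show "AE \<omega> in M. (\<lambda>n. H n \<omega> * W \<omega>) \<longlonglongrightarrow> G \<omega> * W \<omega>"
      by (intro AE_I2 tendsto_intros lim)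
  qed (use G_meas H_meas W_meas in auto)
  moreover have "expectation (\<lambda>\<omega>. H n \<omega> * W \<omega>) = expectation (H n) * expectation W" for n
    using grid(2) by (simp add: H_def W_def)
  ultimately have "expectation (\<lambda>\<omega>. G \<omega> * W \<omega>) = expectation G * expectation W"
    using LIMSEQ_unique by force
  then show ?thesis by (simp add: W_def)
qed

end

subsection \<open>Scores of isolated balls\<close>

text \<open>A remaining point outside the core has distance at least 3/2 from \<open>c\<close>,
  hence at least 3/2 - 1/4 = 5/4 > 1 from every core point. The core has diameter at most 1/2, so
  its points form a clique.\<close>

lemma max_colorable_isolated_ball:
  fixes V :: "'a::euclidean_space set" and c :: 'a
  assumes "finite V" and empty: "V \<inter> (ball c (3/2) - cball c (1/4)) = {}"
  shows "max_colorable k 1 V =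
    max_colorable k 1 (V - ball c (3/2)) + min k (card (V \<inter> cball c (1/4)))"
proof -
  have "cball c (1/4) \<subseteq> ball c (3/2)" by auto
  then have "V = (V - ball c (3/2)) \<union> (V \<inter> cball c (1/4))" using empty by blast
  moreover have "max_colorable k 1 ((V - ball c (3/2)) \<union> (V \<inter> cball c (1/4))) =
      max_colorable k 1 (V - ball c (3/2)) + max_colorable k 1 (V \<inter> cball c (1/4))"
  proof (rule max_colorable_Un)
    fix u v assume "u \<in> V - ball c (3/2)" "v \<in> V \<inter> cball c (1/4)"
    then have "3/2 \<le> dist c u" "dist c v \<le> 1/4" by auto
    then show "1 < norm (u - v)"
      using dist_triangle[of c u v] by (simp add: dist_norm norm_minus_commute)
  qed (use assms in auto)
  moreover have "max_colorable k 1 (V \<inter> cball c (1/4)) = min k (card (V \<inter> cball c (1/4)))"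
  proof (rule max_colorable_clique)
    fix u v assume "u \<in> V \<inter> cball c (1/4)" "v \<in> V \<inter> cball c (1/4)"
    then have "dist c u \<le> 1/4" "dist c v \<le> 1/4" by auto
    then show "norm (u - v) \<le> 1"
      using dist_triangle[of u v c] by (simp add: dist_norm norm_minus_commute)
  qed (use assms in auto)
  ultimately show ?thesis by simp
qed

text \<open>This and the next two facts make the laws of the counts, and hence the variance of a
  score, the same for all centers.\<close>

lemma measure_lborel_ball_translate:
  fixes c :: "'a::euclidean_space"
  assumes "0 \<le> r"
  shows "measure lborel (ball c r) = measure lborel (ball (0::'a) r)"
  by (rule trans[OF content_ball_conv_unit_ball[OF assms] content_ball_conv_unit_ball[OF assms, symmetric]])

lemma measure_lborel_cball_translate:
  fixes c :: "'a::euclidean_space"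
  assumes "0 \<le> r"
  shows "measure lborel (cball c r) = measure lborel (cball (0::'a) r)"
  unfolding content_cball_conv_ball by (rule measure_lborel_ball_translate[OF assms])

lemma measure_lborel_annulus_translate:
  fixes c :: "'a::euclidean_space"
  shows "measure lborel (ball c (3/2) - cball c (1/4)) =
    measure lborel (ball (0::'a) (3/2) - cball 0 (1/4))"
proof -
  have "measure lborel (ball x (3/2) - cball x (1/4)) =
      measure lborel (ball x (3/2)) - measure lborel (cball x (1/4))" for x :: 'a
    using emeasure_lborel_ball_finite[of x "3/2"]
    by (intro measure_Diff) (auto simp: less_top)
  then show ?thesis
    using measure_lborel_ball_translate[of "3/2" c] measure_lborel_cball_translate[of "1/4" c] by simp
qed

context poisson_process
begin

text \<open>The law is that of the count in the core about the origin, so that one constant centers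
  the scores of all balls.\<close>

definition truncated_mean :: "nat \<Rightarrow> real" where
  "truncated_mean k = measure_pmf.expectation
    (poisson_law (intensity * measure lborel (cball (0::'a) (1/4)))) (\<lambda>n. real (min k n))"

text \<open>The score of \<open>c\<close> is the centered number of colorable points in the core \<open>cball c (1/4)\<close>,
  switched off unless the surrounding shell is empty; when it is empty, no edge leaves the core.\<close>

definition local_score :: "nat \<Rightarrow> 'a \<Rightarrow> 'w \<Rightarrow> real" where
  "local_score k c \<omega> = (real (min k (count (cball c (1/4)) \<omega>)) - truncated_mean k) *
    of_bool (count (ball c (3/2) - cball c (1/4)) \<omega> = 0)"

text \<open>The variance of the truncated core count times the probability of an empty shell. Core
  and shell being independent, this is the second moment of a score.\<close>

definition score_variance :: "nat \<Rightarrow> real" where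
  "score_variance k =
    measure_pmf.expectation (poisson_law (intensity * measure lborel (cball (0::'a) (1/4))))
      (\<lambda>n. (real (min k n) - truncated_mean k)\<^sup>2) *
    measure_pmf.expectation
      (poisson_law (intensity * measure lborel (ball (0::'a) (3/2) - cball 0 (1/4))))
      (\<lambda>n. of_bool (n = 0))"

text \<open>The first factor is positive because the core has positive volume; the second is the
  mass of a Poisson law at 0.\<close>

lemma score_variance_pos:
  assumes "1 \<le> k"
  shows "0 < score_variance k"
proof -
  have "measure_pmf.expectation p (\<lambda>n. of_bool (n = 0)) = pmf p 0" for p :: "nat pmf"
    using measure_pmf_single[of p 0]
    by (subst integral_measure_pmf_real[of "{0}"]) (auto simp: pmf.rep_eq)
  then show ?thesis unfolding score_variance_def
    using intensity_pos content_cball_pos[of "1/4" "0::'a"] assms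
    by (auto intro!: mult_pos_pos expectation_poisson_law_truncated_pos pmf_poisson_law_0_pos)
qed

lemma local_score_bound: "\<bar>local_score k c \<omega>\<bar> \<le> real k + \<bar>truncated_mean k\<bar>"
  unfolding local_score_def by (auto simp: of_bool_def)

lemma borel_measurable_local_score: "local_score k c \<in> borel_measurable M"
  unfolding local_score_def
  by (intro borel_measurable_times borel_measurable_diff borel_measurable_const borel_measurable_count)
    auto

lemma expectation_count_pair:
  fixes p q :: "nat \<Rightarrow> real"
  assumes "C \<in> sets borel" "bounded C" "D \<in> sets borel" "bounded D" "C \<inter> D = {}"
    and "\<And>x. \<bar>p x\<bar> \<le> B" "\<And>x. \<bar>q x\<bar> \<le> B"
  shows "expectation (\<lambda>\<omega>. p (count C \<omega>) * q (count D \<omega>)) =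
    expectation (\<lambda>\<omega>. p (count C \<omega>)) * expectation (\<lambda>\<omega>. q (count D \<omega>))"
proof -
  have "disjoint_family_on (\<lambda>i. [C, D] ! i) {..<2::nat}"
    using assms(5) by (auto simp: disjoint_family_on_def less_2_cases_iff disjoint_iff)
  moreover have "[C, D] ! i \<in> sets borel \<and> bounded ([C, D] ! i)" if "i < 2" for i :: nat
    using that assms by (auto simp: less_2_cases_iff)
  moreover have "\<bar>([p, q] ! i) x\<bar> \<le> B" if "i < 2" for i x
    using that assms by (auto simp: less_2_cases_iff)
  ultimately have "expectation (\<lambda>\<omega>. \<Prod>i<2. ([p, q] ! i) (count ([C, D] ! i) \<omega>)) =
    (\<Prod>i<2. expectation (\<lambda>\<omega>. ([p, q] ! i) (count ([C, D] ! i) \<omega>)))"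
    by (intro expectation_prod_count[where B = B]) auto
  then show ?thesis by (simp add: numeral_2_eq_2)
qed

lemma expectation_core_centered:
  "expectation (\<lambda>\<omega>. real (min k (count (cball c (1/4)) \<omega>)) - truncated_mean k) = 0"
proof -
  let ?p = "poisson_law (intensity * measure lborel (cball (0::'a) (1/4)))"
  have "expectation (\<lambda>\<omega>. real (min k (count (cball c (1/4)) \<omega>)) - truncated_mean k) =
      measure_pmf.expectation ?p (\<lambda>n. real (min k n) - truncated_mean k)"
    by (subst expectation_count) (use measure_lborel_cball_translate[of "1/4" c] in auto)
  also have "\<dots> = 0"
    by (subst Bochner_Integration.integral_diff)
      (auto simp: truncated_mean_def intro!: integrable_measure_pmf_bounded[where B = "real k"])
  finally show ?thesis .
qed

lemma expectation_local_score: "expectation (local_score k c) = 0"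
  unfolding local_score_def
  \<comment> \<open>One bound has to serve both factors; the summand 1 covers the indicator.\<close>
  by (subst expectation_count_pair[where B = "real k + \<bar>truncated_mean k\<bar> + 1"
        and p = "\<lambda>n. real (min k n) - truncated_mean k" and q = "\<lambda>n. of_bool (n = 0)"])
    (auto simp: expectation_core_centered)

lemma expectation_local_score_square:
  "expectation (\<lambda>\<omega>. local_score k c \<omega> * local_score k c \<omega>) = score_variance k"
proof -
  let ?B = "real k + \<bar>truncated_mean k\<bar>"
  have "\<bar>(real (min k n) - truncated_mean k)\<^sup>2\<bar> \<le> ?B\<^sup>2 + 1" for n
  proof -
    have "\<bar>real (min k n) - truncated_mean k\<bar> \<le> ?B" by auto
    then have "\<bar>real (min k n) - truncated_mean k\<bar>\<^sup>2 \<le> ?B\<^sup>2" by (rule power_mono) simp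
    then show ?thesis by simp
  qed
  \<comment> \<open>An indicator is its own square, so only the core factor gets squared.\<close>
  moreover have "local_score k c \<omega> * local_score k c \<omega> =
      (real (min k (count (cball c (1/4)) \<omega>)) - truncated_mean k)\<^sup>2 *
      of_bool (count (ball c (3/2) - cball c (1/4)) \<omega> = 0)" for \<omega>
    by (auto simp: local_score_def power2_eq_square of_bool_def)
  ultimately have "expectation (\<lambda>\<omega>. local_score k c \<omega> * local_score k c \<omega>) =
      expectation (\<lambda>\<omega>. (real (min k (count (cball c (1/4)) \<omega>)) - truncated_mean k)\<^sup>2) *
      expectation (\<lambda>\<omega>. of_bool (count (ball c (3/2) - cball c (1/4)) \<omega> = 0))"
    by (simp only:, intro expectation_count_pair[where B = "?B\<^sup>2 + 1"
        and p = "\<lambda>n. (real (min k n) - truncated_mean k)\<^sup>2" and q = "\<lambda>n. of_bool (n = 0)"]) auto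
  also have "expectation (\<lambda>\<omega>. (real (min k (count (cball c (1/4)) \<omega>)) - truncated_mean k)\<^sup>2) =
      measure_pmf.expectation (poisson_law (intensity * measure lborel (cball (0::'a) (1/4))))
        (\<lambda>n. (real (min k n) - truncated_mean k)\<^sup>2)"
    by (subst expectation_count) (use measure_lborel_cball_translate[of "1/4" c] in auto)
  also have "expectation (\<lambda>\<omega>. of_bool (count (ball c (3/2) - cball c (1/4)) \<omega> = 0) :: real) =
      measure_pmf.expectation
        (poisson_law (intensity * measure lborel (ball (0::'a) (3/2) - cball 0 (1/4))))
        (\<lambda>n. of_bool (n = 0))"
    by (subst expectation_count)
      (use measure_lborel_annulus_translate[of c] in \<open>auto intro: bounded_subset[OF bounded_ball]\<close>)
  finally show ?thesis by (simp add: score_variance_def)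
qed

text \<open>Two cores and two shells are four disjoint regions, so the expectation factors over
  them, and the core factor at \<open>c\<close> is centered.\<close>

lemma expectation_local_score_orthogonal:
  assumes disj: "ball c (3/2) \<inter> ball c' (3/2) = {}"
  shows "expectation (\<lambda>\<omega>. local_score k c \<omega> * local_score k c' \<omega>) = 0"
proof -
  define A where "A = (\<lambda>i. [cball c (1/4), ball c (3/2) - cball c (1/4),
    cball c' (1/4), ball c' (3/2) - cball c' (1/4)] ! i)"
  \<comment> \<open>In the list \<open>A\<close> the cores have even and the shells odd
    indices.\<close>
  define f :: "nat \<Rightarrow> nat \<Rightarrow> real" where
    "f = (\<lambda>i n. if even i then real (min k n) - truncated_mean k else of_bool (n = 0))"
  have prod4: "(\<Prod>i<4. h i) = h 0 * h 1 * (h 2 * h 3)" for h :: "nat \<Rightarrow> real"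
    by (simp add: eval_nat_numeral)
  have i4: "i < 4 \<longleftrightarrow> i = 0 \<or> i = 1 \<or> i = 2 \<or> i = 3" for i :: nat by auto
  have sub: "cball x (1/4) \<subseteq> ball x (3/2)" for x :: 'a by auto
  have A0: "A 0 \<subseteq> ball c (3/2)" "A 1 \<subseteq> ball c (3/2)" "A 2 \<subseteq> ball c' (3/2)" "A 3 \<subseteq> ball c' (3/2)"
    using sub by (auto simp: A_def)
  have A1: "A 0 \<inter> A 1 = {}" "A 2 \<inter> A 3 = {}" by (auto simp: A_def)
  have A2: "A 0 \<inter> A 2 = {}" "A 0 \<inter> A 3 = {}" "A 1 \<inter> A 2 = {}" "A 1 \<inter> A 3 = {}"
    using A0 disj by blast+
  have "disjoint_family_on A {..<4}"
    unfolding disjoint_family_on_def using A1 A2 by (auto simp: i4 Int_commute)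
  moreover have "A i \<in> sets borel \<and> bounded (A i)" if "i < 4" for i
    using that unfolding i4 A_def by (auto intro: bounded_subset[OF bounded_ball])
  moreover have "\<bar>f i x\<bar> \<le> real k + \<bar>truncated_mean k\<bar> + 1" for i x
    by (auto simp: f_def)
  ultimately have "expectation (\<lambda>\<omega>. \<Prod>i<4. f i (count (A i) \<omega>)) =
      (\<Prod>i<4. expectation (\<lambda>\<omega>. f i (count (A i) \<omega>)))"
    by (intro expectation_prod_count) auto
  moreover have "expectation (\<lambda>\<omega>. f 0 (count (A 0) \<omega>)) = 0"
    by (simp add: f_def A_def expectation_core_centered)
  moreover have "(\<Prod>i<4. f i (count (A i) \<omega>)) = local_score k c \<omega> * local_score k c' \<omega>" for \<omega>
    unfolding prod4 by (simp add: f_def A_def local_score_def)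
  ultimately show ?thesis unfolding prod4 by simp
qed

lemma expectation_max_colorable_local_score:
  assumes R: "R \<in> sets borel" "bounded R" and ball: "ball c (3/2) \<subseteq> R"
  shows "expectation (\<lambda>\<omega>. real (max_colorable k 1 (X \<omega> \<inter> R)) * local_score k c \<omega>) = score_variance k"
proof -
  define R' where "R' = R - ball c (3/2)"
  define G where "G = (\<lambda>\<omega>. real (max_colorable k 1 (X \<omega> \<inter> R')))"
  have R': "R' \<in> sets borel" "bounded R'"
    using R by (auto simp: R'_def intro: bounded_subset)
  have sub: "cball c (1/4) \<subseteq> ball c (3/2)" by auto
  \<comment> \<open>On an empty shell the core contributes \<open>min k N\<close>, which equals the
    score plus \<open>truncated_mean k\<close>; multiplying by the score gives the three terms.
    Otherwise the score, and with it both sides, is 0.\<close>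
  have "real (max_colorable k 1 (X \<omega> \<inter> R)) * local_score k c \<omega> =
      G \<omega> * local_score k c \<omega> + truncated_mean k * local_score k c \<omega> +
      local_score k c \<omega> * local_score k c \<omega>" if \<omega>: "\<omega> \<in> space M" for \<omega>
  proof (cases "count (ball c (3/2) - cball c (1/4)) \<omega> = 0")
    case True
    have fin: "finite (X \<omega> \<inter> (ball c (3/2) - cball c (1/4)))"
      by (rule locally_finite[OF \<omega>]) (auto intro: bounded_subset[OF bounded_ball])
    have "max_colorable k 1 (X \<omega> \<inter> R) = max_colorable k 1 (X \<omega> \<inter> R - ball c (3/2)) +
        min k (card (X \<omega> \<inter> R \<inter> cball c (1/4)))"
      using True fin by (intro max_colorable_isolated_ball locally_finite \<omega> R) auto
    moreover have "X \<omega> \<inter> R - ball c (3/2) = X \<omega> \<inter> R'" by (auto simp: R'_def)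
    moreover have "X \<omega> \<inter> R \<inter> cball c (1/4) = X \<omega> \<inter> cball c (1/4)" using sub ball by blast
    ultimately show ?thesis using True by (simp add: G_def local_score_def algebra_simps)
  qed (simp add: local_score_def)
  then have "expectation (\<lambda>\<omega>. real (max_colorable k 1 (X \<omega> \<inter> R)) * local_score k c \<omega>) =
      expectation (\<lambda>\<omega>. G \<omega> * local_score k c \<omega> + truncated_mean k * local_score k c \<omega> +
        local_score k c \<omega> * local_score k c \<omega>)"
    by (intro Bochner_Integration.integral_cong) auto
  also have "\<dots> = expectation (\<lambda>\<omega>. G \<omega> * local_score k c \<omega>) +
      truncated_mean k * expectation (local_score k c) + score_variance k"
  proof -
    have Z: "integrable M (local_score k c)"
      using local_score_bound borel_measurable_local_score
      by (intro integrable_const_bound[where B = "real k + \<bar>truncated_mean k\<bar>"]) auto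
    have "integrable M (\<lambda>\<omega>. G \<omega> * local_score k c \<omega>)"
      "integrable M (\<lambda>\<omega>. local_score k c \<omega> * local_score k c \<omega>)"
      using local_score_bound borel_measurable_local_score Z integrable_max_colorable(1)[OF R']
      unfolding G_def by (auto intro!: integrable_mult_bounded)
    then show ?thesis using Z by (simp add: expectation_local_score_square)
  qed
  \<comment> \<open>\<open>G\<close> sees only points outside the ball and the score only counts
    inside it. The product vanishes because the score is centered, and only the second moment
    survives.\<close>
  also have "expectation (\<lambda>\<omega>. G \<omega> * local_score k c \<omega>) = expectation G * expectation (local_score k c)"
    unfolding G_def local_score_def
    by (rule max_colorable_indep[where B = "real k + \<bar>truncated_mean k\<bar> + 1"
          and p = "\<lambda>n. real (min k n) - truncated_mean k" and q = "\<lambda>n. of_bool (n = 0)"])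
      (use R' sub in \<open>auto simp: R'_def intro: bounded_subset[OF bounded_ball]\<close>)
  finally show ?thesis by (simp add: expectation_local_score)
qed

lemma variance_max_colorable_ge:
  assumes R: "R \<in> sets borel" "bounded R" and I: "finite I"
    and balls: "\<And>c. c \<in> I \<Longrightarrow> ball c (3/2) \<subseteq> R"
    and disj: "\<And>c c'. c \<in> I \<Longrightarrow> c' \<in> I \<Longrightarrow> c \<noteq> c' \<Longrightarrow> ball c (3/2) \<inter> ball c' (3/2) = {}"
  shows "real (card I) * score_variance k \<le> variance (\<lambda>\<omega>. real (max_colorable k 1 (X \<omega> \<inter> R)))"
  by (rule variance_ge_sum_orthogonal[OF integrable_max_colorable[OF R] I,
        where Z = "local_score k" and B = "real k + \<bar>truncated_mean k\<bar>"])
    (auto simp: borel_measurable_local_score local_score_bound expectation_local_score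
      expectation_local_score_orthogonal disj expectation_local_score_square
      expectation_max_colorable_local_score[OF R balls])

end

subsection \<open>Packing the cube\<close>

lemma cube_eq_cbox: "cube t = cbox 0 (\<chi> i. t)"
  by (auto simp: cube_def mem_box_cart)

text \<open>These are the centers of the cells of side 3 that tile the cube of side
  \<open>3 * n\<close>; a ball of radius 3/2 is inscribed in each cell.\<close>

definition grid_centers :: "nat \<Rightarrow> (real ^ 'd) set" where
  "grid_centers n = (\<lambda>m. \<chi> i. 3 * real (m i) + 3/2) ` (UNIV \<rightarrow>\<^sub>E {..<n})"

lemma finite_grid_centers: "finite (grid_centers n)"
  unfolding grid_centers_def by (intro finite_imageI finite_PiE) auto

lemma card_grid_centers: "card (grid_centers n :: (real ^ 'd) set) = n ^ CARD('d)"
proof -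
  have "inj_on (\<lambda>m. (\<chi> i. 3 * real (m i) + 3/2) :: real ^ 'd) (UNIV \<rightarrow>\<^sub>E {..<n})"
    by (auto simp: inj_on_def vec_eq_iff fun_eq_iff)
  then show ?thesis by (simp add: grid_centers_def card_image card_PiE)
qed

lemma ball_grid_center_subset_cube:
  assumes "c \<in> grid_centers n" "3 * real n \<le> t"
  shows "ball c (3/2) \<subseteq> cube t"
proof
  fix x assume "x \<in> ball c (3/2)"
  then have x: "norm (c - x) < 3/2" by (simp add: dist_norm)
  obtain m where m: "m \<in> UNIV \<rightarrow>\<^sub>E {..<n}" "c = (\<chi> i. 3 * real (m i) + 3/2)"
    using assms(1) by (auto simp: grid_centers_def)
  have "0 \<le> x $ i \<and> x $ i \<le> t" for i
  proof -
    have "\<bar>c $ i - x $ i\<bar> < 3/2" using component_le_norm_cart[of "c - x" i] x by simp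
    moreover have "Suc (m i) \<le> n" using m(1) by (auto simp: PiE_iff Suc_le_eq)
    then have "real (m i) + 1 \<le> real n" by linarith
    moreover have "c $ i = 3 * real (m i) + 3/2" by (simp add: m(2))
    moreover have "0 \<le> real (m i)" by simp
    ultimately show ?thesis using assms(2) by linarith
  qed
  then show "x \<in> cube t" by (simp add: cube_def)
qed

lemma disjoint_balls_grid_centers:
  assumes "c \<in> grid_centers n" "c' \<in> grid_centers n" "c \<noteq> c'"
  shows "ball c (3/2) \<inter> ball c' (3/2) = {}"
proof -
  obtain m m' :: "'a \<Rightarrow> nat" where m: "c = (\<chi> i. 3 * real (m i) + 3/2)" "c' = (\<chi> i. 3 * real (m' i) + 3/2)"
    using assms by (auto simp: grid_centers_def)
  with assms(3) obtain i where "m i \<noteq> m' i" by (auto simp: vec_eq_iff)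
  then have "1 \<le> \<bar>real (m i) - real (m' i)\<bar>" by linarith
  then have "3 \<le> \<bar>(c - c') $ i\<bar>" by (simp add: m)
  then have "3 \<le> dist c c'" using component_le_norm_cart[of "c - c'" i] by (simp add: dist_norm)
  \<comment> \<open>The distance of the centers reaches the sum of the radii, which suffices because
    the balls are open.\<close>
  then show ?thesis by (intro disjoint_ballI) simp
qed

theorem lemma4:
  fixes M :: "'w measure"
    and X :: "'w \<Rightarrow> (real ^ 'd) set"
    and lam :: real
    and k :: nat
  assumes "lam > 0"
    and "k \<ge> 1"
    and "poisson_process M lam X"
  shows "(INF t \<in> {3<..}. colorable_variance M k X t / t ^ CARD('d)) > 0"
proof -
  interpret poisson_process M lam X by fact
  \<comment> \<open>The 6 comes from halving \<open>t / 3\<close>: as \<open>t > 3\<close>, the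
    floor \<open>n\<close> of \<open>t / 3\<close> is at least 1, so
    \<open>t / 3 < n + 1 \<le> 2 * n\<close>.\<close>
  let ?s = "score_variance k / 6 ^ CARD('d)"
  have "?s \<le> colorable_variance M k X t / t ^ CARD('d)" if t: "3 < t" for t
  proof -
    define n where "n = nat \<lfloor>t / 3\<rfloor>"
    have "1 \<le> \<lfloor>t / 3\<rfloor>" using t by (simp add: le_floor_iff)
    then have "real n = of_int \<lfloor>t / 3\<rfloor>" "1 \<le> real n" by (simp_all add: n_def)
    moreover have "t / 3 < of_int \<lfloor>t / 3\<rfloor> + 1" "of_int \<lfloor>t / 3\<rfloor> \<le> t / 3" by linarith+
    ultimately have n: "3 * real n \<le> t" "t / 6 \<le> real n" by linarith+
    have cube: "(cube t :: (real ^ 'd) set) \<in> sets borel" "bounded (cube t :: (real ^ 'd) set)"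
      by (simp_all add: cube_eq_cbox bounded_cbox)
    have "(t / 6) ^ CARD('d) * score_variance k \<le> real n ^ CARD('d) * score_variance k"
      using n t score_variance_pos[OF assms(2)] by (intro mult_right_mono power_mono) auto
    also have "\<dots> = real (card (grid_centers n :: (real ^ 'd) set)) * score_variance k"
      by (simp add: card_grid_centers)
    also have "\<dots> \<le> variance (\<lambda>\<omega>. real (max_colorable k 1 (X \<omega> \<inter> cube t)))"
      by (intro variance_max_colorable_ge cube finite_grid_centers
          ball_grid_center_subset_cube[OF _ n(1)] disjoint_balls_grid_centers)
    also have "(\<lambda>\<omega>. real (max_colorable k 1 (X \<omega> \<inter> cube t))) = colorable_count k X t"
      by (simp add: colorable_count_def fun_eq_iff Int_commute)
    also have "variance (colorable_count k X t) = colorable_variance M k X t"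
      by (simp add: colorable_variance_def)
    finally show ?thesis using t by (simp add: field_simps power_divide)
  qed
  \<comment> \<open>The bound \<open>?s\<close> is uniform in \<open>t\<close>; positivity of each
    single ratio would not keep the infimum away from 0.\<close>
  then have "?s \<le> (INF t \<in> {3<..}. colorable_variance M k X t / t ^ CARD('d))"
    by (intro cINF_greatest) auto
  moreover have "0 < ?s" using score_variance_pos[OF assms(2)] by simp
  ultimately show ?thesis by linarith
qed

end
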